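(* For every $\mu\in\mathbb{R}$ and every positive integer $n$, there exist values of $\lambda\in\mathbb{R}$ such that the map $f:\mathbb{R}\to\mathbb{R}$, $f(x)=\lfloor\lambda x+\mu\rfloor$, has exactly $n$ fixed points; in particular, $f$ has exactly $n$ fixed points both for $\lambda=\frac{n-1}{n}$ and for $\lambda=\frac{n+1}{n}$.
   Context: $\lfloor\cdot\rfloor$ denotes the floor function. A fixed point of $f$ is an $x\in\mathbb{R}$ with $f(x)=x$. *)

theory Defs
  imports Complex_Main
begin

definition floor_map :: "real \<Rightarrow> real \<Rightarrow> real \<Rightarrow> real" where
  "floor_map l \<mu> x = real_of_int \<lfloor>l * x + \<mu>\<rfloor>"

definition fixed_points :: "('a \<Rightarrow> 'a) \<Rightarrow> 'a set" where
  "fixed_points f = {x. f x = x}"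

(* finite is needed: card of an infinite set is 0 *)
definition has_exactly_fixed_points :: "('a \<Rightarrow> 'a) \<Rightarrow> nat \<Rightarrow> bool" where
  "has_exactly_fixed_points f n \<longleftrightarrow> finite (fixed_points f) \<and> card (fixed_points f) = n"

end

(* A fixed point is an integer k with 0 \<le> (\<lambda> - 1) k + \<mu> < 1. For \<lambda> - 1 = -1/n or 1/n this confines
   k to a half-open real interval of length n, which contains exactly n integers. *)
theory Submission
  imports Defs
begin

text \<open>Every value of a floor is an integer, so only integers can be fixed. For an integer
  \<open>k\<close>, subtract \<open>k\<close> throughout
  \<open>k \<le> l * k + \<mu> < k + 1\<close>.\<close>

lemma fixed_points_floor_map:
  "fixed_points (floor_map l \<mu>)
    = real_of_int ` {k. 0 \<le> (l - 1) * of_int k + \<mu> \<and> (l - 1) * of_int k + \<mu> < 1}"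
proof -
  have "\<lfloor>l * of_int k + \<mu>\<rfloor> = k \<longleftrightarrow>
      0 \<le> (l - 1) * of_int k + \<mu> \<and> (l - 1) * of_int k + \<mu> < 1" for k :: int
    by (auto simp: floor_eq_iff algebra_simps)
  then show ?thesis
    unfolding fixed_points_def floor_map_def image_def
    by auto (metis of_int_floor_cancel)+
qed

text \<open>Reduces counting to exhibiting a start \<open>a\<close>; \<open>real_of_int\<close> is
  injective, so the \<open>n\<close> integers give \<open>n\<close> real fixed points.\<close>

lemma has_exactly_fixed_points_floor_mapI:
  assumes "{k. 0 \<le> (l - 1) * of_int k + \<mu> \<and> (l - 1) * of_int k + \<mu> < 1} = {a..<a + int n}"
  shows "has_exactly_fixed_points (floor_map l \<mu>) n"
  unfolding has_exactly_fixed_points_def fixed_points_floor_map assms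
  by (simp add: card_image inj_on_def)

theorem mainTheorem5:
  fixes \<mu> :: real and n :: nat
  assumes "n \<ge> 1"
  shows "(\<exists>l::real. has_exactly_fixed_points (floor_map l \<mu>) n)
    \<and> has_exactly_fixed_points (floor_map ((real n - 1) / real n) \<mu>) n
    \<and> has_exactly_fixed_points (floor_map ((real n + 1) / real n) \<mu>) n"
proof -
  have n: "real n > 0"
    using assms by simp
  \<comment> \<open>The coefficient is \<open>-1/n\<close>; scaling by \<open>n\<close> gives
    \<open>n * \<mu> - n < k \<le> n * \<mu>\<close>. The left end is excluded, hence the
    \<open>+ 1\<close>.\<close>
  have "0 \<le> ((real n - 1) / real n - 1) * of_int k + \<mu> \<and>
      ((real n - 1) / real n - 1) * of_int k + \<mu> < 1 \<longleftrightarrow>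
      k \<in> {\<lfloor>n * \<mu>\<rfloor> - int n + 1..<\<lfloor>n * \<mu>\<rfloor> - int n + 1 + int n}" for k :: int
  proof -
    have "((real n - 1) / real n - 1) * of_int k + \<mu> = (n * \<mu> - of_int k) / n"
      using n by (simp add: field_simps)
    \<comment> \<open>Grouping \<open>k + int n\<close> under one \<open>of_int\<close> leaves an
      integer against \<open>n * \<mu>\<close>, the form that the floor rules compare.\<close>
    then have "0 \<le> ((real n - 1) / real n - 1) * of_int k + \<mu> \<and>
        ((real n - 1) / real n - 1) * of_int k + \<mu> < 1 \<longleftrightarrow>
        of_int k \<le> n * \<mu> \<and> n * \<mu> < of_int (k + int n)"
      using n by (auto simp: field_simps)
    also have "\<dots> \<longleftrightarrow> k \<le> \<lfloor>n * \<mu>\<rfloor> \<and> \<lfloor>n * \<mu>\<rfloor> < k + int n"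
      unfolding le_floor_iff floor_less_iff ..
    finally show ?thesis
      by auto
  qed
  then have minus: "has_exactly_fixed_points (floor_map ((real n - 1) / real n) \<mu>) n"
    by (intro has_exactly_fixed_points_floor_mapI) blast
  \<comment> \<open>Now the coefficient is \<open>1/n\<close>, giving
    \<open>- (n * \<mu>) \<le> k < - (n * \<mu>) + n\<close>. The left end is included, so the run
    starts at the ceiling without a shift.\<close>
  have "0 \<le> ((real n + 1) / real n - 1) * of_int k + \<mu> \<and>
      ((real n + 1) / real n - 1) * of_int k + \<mu> < 1 \<longleftrightarrow>
      k \<in> {\<lceil>- (n * \<mu>)\<rceil>..<\<lceil>- (n * \<mu>)\<rceil> + int n}" for k :: int
  proof -
    have "((real n + 1) / real n - 1) * of_int k + \<mu> = (of_int k + n * \<mu>) / n"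
      using n by (simp add: field_simps)
    then have "0 \<le> ((real n + 1) / real n - 1) * of_int k + \<mu> \<and>
        ((real n + 1) / real n - 1) * of_int k + \<mu> < 1 \<longleftrightarrow>
        - (n * \<mu>) \<le> of_int k \<and> of_int (k - int n) < - (n * \<mu>)"
      using n by (auto simp: field_simps)
    also have "\<dots> \<longleftrightarrow> \<lceil>- (n * \<mu>)\<rceil> \<le> k \<and> k - int n < \<lceil>- (n * \<mu>)\<rceil>"
      unfolding ceiling_le_iff less_ceiling_iff ..
    finally show ?thesis
      by auto
  qed
  then have plus: "has_exactly_fixed_points (floor_map ((real n + 1) / real n) \<mu>) n"
    by (intro has_exactly_fixed_points_floor_mapI) blast
  from minus plus show ?thesis
    by blast
qed

end
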